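(* Suppose $G$ is a connected graph with metamour period $2$ and $\operatorname{diam}(G)=3$. Then $G$ contains a subgraph isomorphic to $\widehat{C}_5$.
   Context: All graphs are finite and simple. The metamour graph $\operatorname{M}(G)$ has vertex set $V(G)$, with $x,y$ adjacent iff $d_G(x,y)=2$ (graph distance). $G$ has metamour period $2$ if $\operatorname{M}(\operatorname{M}(G))=G$ (equality as labeled graphs) and $\operatorname{M}(G)\ne G$. $\operatorname{diam}(G)$ is the maximum distance between vertices. $\widehat{C}_5$ denotes the graph on six vertices obtained from the $5$-cycle $C_5$ by adding one additional vertex that is connected to (exactly) two adjacent vertices of $C_5$. A subgraph need not be induced. *)

theory Defs
  imports "Graph_Theory.Digraph_Isomorphism" "Graph_Theory.Shortest_Path"
begin

text \<open>
  A finite simple graph is a \<^locale>\<open>pair_graph\<close>: a finite, symmetric, loopfree digraph whose arcs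
  are pairs of vertices. An undirected edge is represented by its two arcs.
\<close>

text \<open>
  The graph distance is the infimum of the walk costs for unit weights. It takes values in
  \<^typ>\<open>ereal\<close>, so that vertices in different components are at distance infinity
  (this matters because a metamour graph may be disconnected).
\<close>

definition gdist :: "'a pair_pre_digraph \<Rightarrow> 'a \<Rightarrow> 'a \<Rightarrow> ereal" where
  "gdist G = wf_digraph.\<mu> (with_proj G) (\<lambda>_. 1)"

definition diam :: "'a pair_pre_digraph \<Rightarrow> ereal" where
  "diam G = Max {gdist G u v | u v. u \<in> pverts G \<and> v \<in> pverts G}"

definition metamour_graph :: "'a pair_pre_digraph \<Rightarrow> 'a pair_pre_digraph" where
  "metamour_graph G =
    \<lparr> pverts = pverts G,
      parcs = {(x, y). x \<in> pverts G \<and> y \<in> pverts G \<and> gdist G x y = 2} \<rparr>"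

definition metamour_period_2 :: "'a pair_pre_digraph \<Rightarrow> bool" where
  "metamour_period_2 G \<longleftrightarrow> metamour_graph (metamour_graph G) = G \<and> metamour_graph G \<noteq> G"

definition C5 :: "nat pair_pre_digraph" where
  "C5 = \<lparr> pverts = {0..<5},
          parcs = {(i, j). i < 5 \<and> j < 5 \<and> (j = (i + 1) mod 5 \<or> i = (j + 1) mod 5)} \<rparr>"

text \<open>The vertex 5 is the additional one; 0 and 1 are adjacent on the cycle.\<close>

definition C5_hat :: "nat pair_pre_digraph" where
  "C5_hat = \<lparr> pverts = insert 5 (pverts C5),
              parcs = parcs C5 \<union> {(5, 0), (0, 5), (5, 1), (1, 5)} \<rparr>"

lemma (in pair_wf_digraph) gdist_eq:
  "gdist G u v = (INF p\<in>{p. awalk u p v}. ereal (length p))"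
proof -
  have "awalk_cost (\<lambda>_. 1) p = real (length p)" for p :: "('a \<times> 'a) awalk"
    by (induction p) simp_all
  then show ?thesis
    by (simp add: gdist_def \<mu>_def)
qed

lemma (in pair_wf_digraph) gdist_self:
  assumes "u \<in> pverts G"
  shows "gdist G u u = 0"
proof (rule antisym)
  have "awalk u [] u"
    using assms by (simp add: awalk_Nil_iff)
  then show "gdist G u u \<le> 0"
    unfolding gdist_eq by (intro INF_lower2[of "[]"]) auto
  show "0 \<le> gdist G u u"
    unfolding gdist_eq by (intro INF_greatest) auto
qed

lemma (in pair_sym_digraph) gdist_commute: "gdist G u v = gdist G v u"
proof -
  have len: "length (rev_path p) = length p" for p :: "('a \<times> 'a) awalk"
    by (induction p) simp_all
  have le: "gdist G x y \<le> gdist G y x" for x y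
    unfolding gdist_eq
  proof (rule INF_greatest)
    fix p assume "p \<in> {p. awalk y p x}"
    then have "awalk x (rev_path p) y"
      by (simp add: awalk_rev_path')
    then show "(INF p\<in>{p. awalk x p y}. ereal (length p)) \<le> ereal (length p)"
      by (intro INF_lower2[of "rev_path p"]) (auto simp: len)
  qed
  show ?thesis
    by (intro antisym le)
qed

lemma (in pair_graph) pair_graph_metamour_graph: "pair_graph (metamour_graph G)"
proof -
  have "parcs (metamour_graph G) \<subseteq> pverts G \<times> pverts G"
    by (auto simp: metamour_graph_def)
  then have "finite (parcs (metamour_graph G))"
    using finite_subset pair_finite_verts by blast
  then show ?thesis
    using pair_finite_verts
    by unfold_locales
       (auto simp: metamour_graph_def gdist_self gdist_commute symmetric_def intro!: symI)
qed

lemma pair_graph_C5_hat: "pair_graph C5_hat"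
proof -
  have "parcs C5 \<subseteq> pverts C5 \<times> pverts C5" "finite (pverts C5)"
    by (auto simp: C5_def)
  then have "finite (parcs C5)"
    using finite_subset by blast
  then show ?thesis
    by unfold_locales
       (auto simp: C5_hat_def C5_def symmetric_def mod_Suc split: if_splits intro!: symI)
qed

end

theory Submission
  imports Defs
begin

text \<open>
  Write x \<sim> y for adjacency in the graph G and x \<approx> y for adjacency in its metamour graph.
  Period two makes the two relations dual to each other: x \<approx> y holds iff x and y are distinct,
  not related by \<sim>, and have a common \<sim>-neighbour, and the same is true with \<sim> and
  \<approx> exchanged. Two distinct vertices that are related by neither relation therefore have no
  common neighbour of either kind.

  Take a, b at distance three and a path a \<sim> u \<sim> v \<sim> b. The edge a \<sim> u has a
  common \<approx>-neighbour w, which differs from b because a \<approx> b fails. Since w and b have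
  the common \<approx>-neighbour u, they are related, and w \<approx> b is excluded because it would
  make w a common \<approx>-neighbour of a and b; so w \<sim> b. Now a \<approx> w and u \<approx> w
  provide vertices x and y with a \<sim> x \<sim> w and u \<sim> y \<sim> w, and there are three
  ways to find a five-cycle with a triangle on one of its edges:

  \<^item> if w \<sim> v, the cycle v, w, x, a, u with b on the edge from v to w;
  \<^item> if y \<sim> a but not w \<sim> v (so that y \<noteq> v), the cycle u, y, w, b, v with a on
    the edge from u to y;
  \<^item> if y \<sim> b (so that y \<noteq> x, as a and b have no common neighbour), the cycle
    w, y, u, a, x with b on the edge from w to y.

  These cases suffice: if y is adjacent to neither
  a nor b, then it is at distance two from a (through u) and from b (through w), so that it is a
  common \<approx>-neighbour of a and b, a contradiction.

  The lemma \<open>dual_relations_five_cycle_with_triangle\<close> is this argument. The lemma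
  \<open>gdist_eq_2_iff\<close>, applied to G and to its metamour graph, gives the duality, and
  \<open>C5_hat_subgraphI\<close> turns the six vertices into a subgraph.
\<close>

section \<open>Small graph distances\<close>

text \<open>
  Walk lengths are natural numbers, so the infimum that defines the distance is attained as soon
  as there is a walk; without a walk it is infinite.
\<close>

lemma (in pair_wf_digraph) gdist_eq_nat_iff:
  "gdist G u v = ereal (real n) \<longleftrightarrow>
    (\<exists>p. awalk u p v \<and> length p = n) \<and> (\<forall>p. awalk u p v \<longrightarrow> n \<le> length p)"
    (is "_ \<longleftrightarrow> ?shortest n")
proof (cases "\<exists>p. awalk u p v")
  case False
  then have "gdist G u v = \<infinity>"
    by (simp add: gdist_eq top_ereal_def)
  with False show ?thesis by auto
next
  case True
  define m where "m = (LEAST k. \<exists>p. awalk u p v \<and> length p = k)"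
  have attained: "\<exists>p. awalk u p v \<and> length p = m"
    unfolding m_def by (rule LeastI_ex) (use True in blast)
  have minimal: "m \<le> length p" if "awalk u p v" for p
    unfolding m_def by (rule Least_le) (use that in blast)
  have "gdist G u v = ereal (real m)"
  proof (rule antisym)
    show "gdist G u v \<le> ereal (real m)"
      using attained unfolding gdist_eq by (auto intro: INF_lower)
    show "ereal (real m) \<le> gdist G u v"
      using minimal unfolding gdist_eq by (auto intro!: INF_greatest)
  qed
  moreover have "?shortest n \<longleftrightarrow> n = m"
    using attained minimal by (metis le_antisym)
  ultimately show ?thesis by auto
qed

lemma (in pair_graph) gdist_eq_2_iff:
  assumes "x \<in> pverts G" "y \<in> pverts G"
  shows "gdist G x y = 2 \<longleftrightarrow>
    x \<noteq> y \<and> (x, y) \<notin> parcs G \<and> (\<exists>z. (x, z) \<in> parcs G \<and> (z, y) \<in> parcs G)"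
proof -
  have "gdist G x y = 2 \<longleftrightarrow>
    (\<exists>p. awalk x p y \<and> length p = 2) \<and> (\<forall>p. awalk x p y \<longrightarrow> 2 \<le> length p)"
    using gdist_eq_nat_iff[of x y 2] by simp
  moreover have "(\<exists>p. awalk x p y \<and> length p = 2) \<longleftrightarrow>
    (\<exists>z. (x, z) \<in> parcs G \<and> (z, y) \<in> parcs G)" (is "?L \<longleftrightarrow> ?R")
  proof
    assume ?L
    then show ?R by (auto simp: awalk_simps length_Suc_conv numeral_eq_Suc)
  next
    assume ?R
    then obtain z where "awalk x [(x, z), (z, y)] y"
      using assms by (auto simp: awalk_simps)
    then show ?L by (intro exI[of _ "[(x, z), (z, y)]"]) simp
  qed
  moreover have "(\<forall>p. awalk x p y \<longrightarrow> 2 \<le> length p) \<longleftrightarrow> x \<noteq> y \<and> (x, y) \<notin> parcs G"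
    (is "?L \<longleftrightarrow> ?R")
  proof
    assume minimal: ?L
    \<comment> \<open>The walks of length zero and one are the only ones that minimality has to exclude.\<close>
    show ?R
      using minimal[rule_format, of "[]"] minimal[rule_format, of "[(x, y)]"] assms
      by (auto simp: awalk_simps)
  next
    assume ?R
    have "2 \<le> length p" if "awalk x p y" for p
      using that \<open>?R\<close> by (cases p; cases "tl p") (auto simp: awalk_simps)
    then show ?L by blast
  qed
  ultimately show ?thesis by blast
qed

lemma (in pair_graph) gdist_eq_3_path:
  assumes "gdist G a b = 3"
  obtains u v where "(a, u) \<in> parcs G" "(u, v) \<in> parcs G" "(v, b) \<in> parcs G"
    "a \<noteq> b" "(a, b) \<notin> parcs G"
proof -
  have dist: "gdist G a b = ereal (real 3)" using assms by simp
  then obtain p where "awalk a p b" "length p = 3"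
    unfolding gdist_eq_nat_iff by blast
  then obtain u v where path: "(a, u) \<in> parcs G" "(u, v) \<in> parcs G" "(v, b) \<in> parcs G"
    by (auto simp: awalk_simps length_Suc_conv numeral_eq_Suc)
  then have "a \<in> pverts G" "b \<in> pverts G"
    by (blast dest: in_arcsD1 in_arcsD2)+
  have minimal: "3 \<le> length p" if "awalk a p b" for p
    using that dist unfolding gdist_eq_nat_iff by blast
  have "a \<noteq> b" "(a, b) \<notin> parcs G"
    using minimal[of "[]"] minimal[of "[(a, b)]"] \<open>b \<in> pverts G\<close>
    by (auto simp: awalk_simps)
  with path that show thesis by blast
qed

lemma (in pair_graph) diam_attained:
  assumes "pverts G \<noteq> {}"
  obtains a b where "a \<in> pverts G" "b \<in> pverts G" "gdist G a b = diam G"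
proof -
  let ?D = "{gdist G u v | u v. u \<in> pverts G \<and> v \<in> pverts G}"
  have "finite ?D"
    using finite_image_set2[of "\<lambda>u. u \<in> pverts G" "\<lambda>v. v \<in> pverts G"] pair_finite_verts
    by simp
  moreover have "?D \<noteq> {}" using assms by blast
  ultimately have "diam G \<in> ?D" unfolding diam_def by (rule Max_in)
  with that show thesis by auto
qed

section \<open>Embedded copies of a graph\<close>

text \<open>
  The image of \<open>K\<close> keeps only the arcs that come from \<open>K\<close>, so the copy need
  not be induced and \<open>f\<close> only has to preserve arcs, not reflect them.
\<close>

lemma embedding_imp_isomorphic_subgraph:
  assumes "pair_wf_digraph G" "pair_wf_digraph K"
    and inj: "inj_on f (pverts K)"
    and verts: "f ` pverts K \<subseteq> pverts G"
    and arcs: "\<And>i j. (i, j) \<in> parcs K \<Longrightarrow> (f i, f j) \<in> parcs G"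
  shows "\<exists>H. subgraph H (with_proj G) \<and> digraph_iso H (with_proj K)"
proof -
  interpret G: pair_wf_digraph G by fact
  interpret K: pair_wf_digraph K by fact
  define hom where "hom = \<lparr> iso_verts = f, iso_arcs = map_prod f f, iso_head = snd, iso_tail = fst \<rparr>"
  let ?H = "app_iso hom (with_proj K)"
  have "inj_on (map_prod f f) (parcs K)"
    by (rule inj_on_subset[OF map_prod_inj_on[OF inj inj]]) (auto dest: K.in_arcsD1 K.in_arcsD2)
  then have hom: "K.digraph_isomorphism hom"
    using inj by (auto simp: K.digraph_isomorphism_def hom_def K.wf_digraph_axioms)
  then have "subgraph ?H (with_proj G)"
    using verts arcs K.wf_digraphI_app_iso[OF hom]
    by (auto simp: subgraph_def compatible_def hom_def G.wf_digraph_axioms)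
  moreover have "digraph_iso (with_proj K) ?H"
    using hom by (auto simp: digraph_iso_def)
  then have "digraph_iso ?H (with_proj K)"
    by (rule digraph_iso_swap[OF K.wf_digraph_axioms])
  ultimately show ?thesis by blast
qed

lemma (in pair_graph) C5_hat_subgraphI:
  assumes "distinct [c0, c1, c2, c3, c4, t]"
    and "(c0, c1) \<in> parcs G" "(c1, c2) \<in> parcs G" "(c2, c3) \<in> parcs G"
      "(c3, c4) \<in> parcs G" "(c4, c0) \<in> parcs G" "(t, c0) \<in> parcs G" "(t, c1) \<in> parcs G"
  shows "\<exists>H. subgraph H (with_proj G) \<and> digraph_iso H (with_proj C5_hat)"
proof -
  let ?f = "\<lambda>i. [c0, c1, c2, c3, c4, t] ! i"
  have sym: "(y, x) \<in> parcs G" if "(x, y) \<in> parcs G" for x y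
    using that by (rule arcs_symmetric)
  have verts: "pverts C5_hat = {..<6}" by (auto simp: C5_hat_def C5_def)
  have cycle: "(?f i, ?f ((i + 1) mod 5)) \<in> parcs G" if "i < 5" for i
  proof -
    consider "i = 0" | "i = 1" | "i = 2" | "i = 3" | "i = 4"
      using \<open>i < 5\<close> by (auto simp: less_Suc_eq numeral_eq_Suc)
    then show ?thesis using assms(2-6) by cases simp_all
  qed
  show ?thesis
  proof (rule embedding_imp_isomorphic_subgraph[where f = ?f])
    show "pair_wf_digraph G" ..
    interpret K: pair_graph C5_hat by (rule pair_graph_C5_hat)
    show "pair_wf_digraph C5_hat" ..
    show "inj_on ?f (pverts C5_hat)"
      unfolding verts using assms(1) by (intro inj_on_nth) auto
    have in_verts: "set [c0, c1, c2, c3, c4, t] \<subseteq> pverts G"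
      using assms(2-8) by (auto dest: in_arcsD1 in_arcsD2)
    show "?f ` pverts C5_hat \<subseteq> pverts G"
    proof (rule image_subsetI)
      fix i assume "i \<in> pverts C5_hat"
      then have "?f i \<in> set [c0, c1, c2, c3, c4, t]"
        unfolding verts by (intro nth_mem) simp
      then show "?f i \<in> pverts G" using in_verts by (rule subsetD[rotated])
    qed
    show "(?f i, ?f j) \<in> parcs G" if "(i, j) \<in> parcs C5_hat" for i j
    proof -
      consider "i < 5" "j = (i + 1) mod 5" | "j < 5" "i = (j + 1) mod 5"
        | "(i, j) \<in> {(5, 0), (0, 5), (5, 1), (1, 5)}"
        using \<open>(i, j) \<in> parcs C5_hat\<close> unfolding C5_hat_def C5_def by auto
      then show ?thesis
      proof cases
        case 1
        then show ?thesis using cycle by blast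
      next
        case 2
        then show ?thesis using cycle sym by blast
      next
        case 3
        then show ?thesis using assms(7,8) sym by auto
      qed
    qed
  qed
qed

section \<open>Period two and the five-cycle with a triangle\<close>

text \<open>
  The argument uses only the symmetry of adjacency and the duality of the two adjacency relations,
  so it is carried out for abstract relations. The vertices \<open>c0\<close> to \<open>c4\<close> form the cycle,
  and \<open>t\<close> completes the triangle on the edge from \<open>c0\<close> to \<open>c1\<close>.
\<close>

lemma dual_relations_five_cycle_with_triangle:
  assumes sym: "\<And>x y. E x y \<Longrightarrow> E y x"
    and F_iff: "\<And>x y. F x y \<longleftrightarrow> x \<noteq> y \<and> \<not> E x y \<and> (\<exists>z. E x z \<and> E z y)"
    and E_iff: "\<And>x y. E x y \<longleftrightarrow> x \<noteq> y \<and> \<not> F x y \<and> (\<exists>z. F x z \<and> F z y)"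
    and path: "E a u" "E u v" "E v b"
    and far: "a \<noteq> b" "\<not> E a b" "\<not> F a b"
  shows "\<exists>c0 c1 c2 c3 c4 t. distinct [c0, c1, c2, c3, c4, t] \<and>
    E c0 c1 \<and> E c1 c2 \<and> E c2 c3 \<and> E c3 c4 \<and> E c4 c0 \<and> E t c0 \<and> E t c1"
proof -
  have F_sym: "F y x" if "F x y" for x y
    using that sym unfolding F_iff by blast
  have irrefl: "\<not> E x x" "\<not> F x x" for x
    using E_iff F_iff by blast+
  have disjoint: "\<not> F x y" if "E x y" for x y
    using that E_iff by blast
  have no_common_E: "\<not> (E a z \<and> E z b)" for z
    using far F_iff by blast
  have no_common_F: "\<not> (F a z \<and> F z b)" for z
    using far E_iff by blast
  have "F a v" "F u b"
    using path far no_common_E irrefl F_iff sym by metis+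
  obtain w where w: "F a w" "F w u" using path(1) E_iff by blast
  have "w \<noteq> b" using w far by blast
  have "E w b"
    using E_iff[of w b] w \<open>F u b\<close> \<open>w \<noteq> b\<close> no_common_F by blast
  obtain x where x: "E a x" "E x w"
    using F_iff[THEN iffD1, OF w(1)] by blast
  obtain y where y: "E u y" "E y w"
    using F_iff[THEN iffD1, OF w(2)] sym by blast
  have distinct_if_E: "p \<noteq> q" if "E p q" for p q using that irrefl by blast
  have distinct_if_F: "p \<noteq> q" if "F p q" for p q using that irrefl by blast
  have distinct_path: "distinct [a, u, v, b]"
    using path[THEN distinct_if_E] far(1) \<open>F a v\<close>[THEN distinct_if_F] \<open>F u b\<close>[THEN distinct_if_F]
    by simp
  \<comment> \<open>The vertices differ because some third vertex is related to them in different ways.\<close>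
  have "w \<noteq> v" using w(2) F_sym path(2) disjoint by blast
  then have w_new: "w \<notin> {a, u, v, b}"
    using w[THEN distinct_if_F] \<open>w \<noteq> b\<close> by simp
  have "x \<noteq> u" "x \<noteq> v" "x \<noteq> b"
    using x w(2) F_sym disjoint \<open>F a v\<close> far(2) by blast+
  then have x_new: "x \<notin> {a, u, v, b, w}"
    using x[THEN distinct_if_E] by simp
  have "y \<noteq> a" "y \<noteq> b"
    using y w(1) disjoint \<open>F u b\<close> by blast+
  then have y_new: "y \<notin> {a, u, b, w}"
    using y[THEN distinct_if_E] by simp
  consider "E w v" | "\<not> E w v" "E y a" | "E y b" | "\<not> E y a" "\<not> E y b"
    by blast
  then show ?thesis
  proof cases
    case 1
    have "distinct [v, w, x, a, u, b]"
      using distinct_path w_new x_new by auto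
    moreover have "E v w" "E w x" "E x a" "E a u" "E u v" "E b v" "E b w"
      using 1 x path \<open>E w b\<close> sym by blast+
    ultimately show ?thesis by blast
  next
    case 2
    have "y \<noteq> v" using 2(1) y(2) sym by blast
    then have "distinct [u, y, w, b, v, a]"
      using distinct_path w_new y_new by auto
    moreover have "E u y" "E y w" "E w b" "E b v" "E v u" "E a u" "E a y"
      using 2 y path \<open>E w b\<close> sym by blast+
    ultimately show ?thesis by blast
  next
    case 3
    have "x \<noteq> y" using 3 x(1) no_common_E by blast
    then have "distinct [w, y, u, a, x, b]"
      using distinct_path w_new x_new y_new by auto
    moreover have "E w y" "E y u" "E u a" "E a x" "E x w" "E b w" "E b y"
      using 3 x y path \<open>E w b\<close> sym by blast+
    ultimately show ?thesis by blast
  next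
    case 4
    have "F a y"
      using F_iff[of a y] \<open>y \<noteq> a\<close> 4(1) path(1) y(1) sym by blast
    moreover have "F y b"
      using F_iff[of y b] \<open>y \<noteq> b\<close> 4(2) y(2) \<open>E w b\<close> by blast
    ultimately show ?thesis using no_common_F by blast
  qed
qed

theorem theorem6p6:
  fixes G :: "'a pair_pre_digraph"
  assumes "pair_graph G"
    and "connected (with_proj G)"
    and "metamour_period_2 G"
    and "diam G = 3"
  shows "\<exists>H. subgraph H (with_proj G) \<and> digraph_iso H (with_proj C5_hat)"
proof -
  interpret G: pair_graph G by fact
  interpret M: pair_graph "metamour_graph G" by (rule G.pair_graph_metamour_graph)
  let ?E = "\<lambda>x y. (x, y) \<in> parcs G"
  let ?F = "\<lambda>x y. (x, y) \<in> parcs (metamour_graph G)"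
  have verts: "pverts (metamour_graph G) = pverts G"
    by (simp add: metamour_graph_def)
  have F_iff: "?F x y \<longleftrightarrow> x \<noteq> y \<and> \<not> ?E x y \<and> (\<exists>z. ?E x z \<and> ?E z y)" for x y
  proof -
    have "?F x y \<longleftrightarrow> x \<in> pverts G \<and> y \<in> pverts G \<and> gdist G x y = 2"
      by (simp add: metamour_graph_def)
    then show ?thesis
      using G.gdist_eq_2_iff[of x y] G.in_arcsD1 G.in_arcsD2 by blast
  qed
  have E_iff: "?E x y \<longleftrightarrow> x \<noteq> y \<and> \<not> ?F x y \<and> (\<exists>z. ?F x z \<and> ?F z y)" for x y
  proof -
    have "parcs G = parcs (metamour_graph (metamour_graph G))"
      using assms(3) by (simp add: metamour_period_2_def)
    then have "?E x y \<longleftrightarrow> x \<in> pverts G \<and> y \<in> pverts G \<and> gdist (metamour_graph G) x y = 2"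
      by (simp add: metamour_graph_def[of "metamour_graph G"] verts)
    then show ?thesis
      using M.gdist_eq_2_iff[of x y] M.in_arcsD1 M.in_arcsD2 verts by blast
  qed
  have "pverts G \<noteq> {}"
    using assms(2) by (auto simp: connected_def strongly_connected_def mk_symmetric_def)
  then obtain a b where ab: "gdist G a b = 3"
    using G.diam_attained assms(4) by metis
  obtain u v where path: "?E a u" "?E u v" "?E v b" and far: "a \<noteq> b" "\<not> ?E a b"
    using ab by (rule G.gdist_eq_3_path)
  have "\<not> ?F a b" using ab by (simp add: metamour_graph_def)
  then obtain c0 c1 c2 c3 c4 t where "distinct [c0, c1, c2, c3, c4, t]"
    "?E c0 c1" "?E c1 c2" "?E c2 c3" "?E c3 c4" "?E c4 c0" "?E t c0" "?E t c1"
    using dual_relations_five_cycle_with_triangle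
      [of ?E ?F, OF G.arcs_symmetric F_iff E_iff path far] by blast
  then show ?thesis by (rule G.C5_hat_subgraphI)
qed

end
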